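(* Consider a min-plus linear system with random service process $S_\omega(\tau,t)$, $\omega\in\Omega$, that is additive for every $\omega$. Let $D_\omega(t)=S_\omega(0,t)$ be its burst response, i.e., the departures for the burst probe $\delta$. Let $\varepsilon\in(0,1]$, and for each $t>0$ let $\Psi_t\subseteq\Omega$ be a (non-empty) set of sample paths with $\mathsf{P}[\Psi_t]\ge1-\varepsilon$. Define $$\mathcal{S}_{br}^{\varepsilon}(\tau,t)=\inf_{\psi\in\Psi_t}\{D_\psi(t)-D_\psi(\tau)\},\qquad \tau\in[0,t].$$ Then $\mathsf{P}\bigl[S(\tau,t)\ge\mathcal{S}_{br}^{\varepsilon}(\tau,t)\ \forall\tau\in[0,t]\bigr]\ge1-\varepsilon$ for all $t>0$, and hence $\mathcal{S}_{br}^{\varepsilon}$ is a non-stationary service curve: for any arrivals $A$ with corresponding departures $D$ and all $t>0$, $\mathsf{P}\bigl[D(t)\ge\inf_{\tau\in[0,t]}\{A(\tau)+\mathcal{S}_{br}^{\varepsilon}(\tau,t)\}\bigr]\ge1-\varepsilon$.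
   Context: A random service process $S(\tau,t)$, $t\ge\tau\ge0$, is a family of non-negative real random variables on a probability space $\Omega$ with $S(t,t)=0$ for all $t\ge0$. Min-plus linear system: for any arrivals $A$ (non-negative, non-decreasing, $A(0)=0$), the departures are $D(t)=\inf_{\tau\in[0,t]}\{A(\tau)+S(\tau,t)\}$ for all $t\ge0$. The burst probe is $\delta(0)=0$ and $\delta(t)=\infty$ for $t>0$. The service process is additive if $S(s,u)=S(s,t)+S(t,u)$ for all $u\ge t\ge s\ge0$. All events whose probability is taken are assumed measurable (automatic in discrete time). *)

theory Defs
  imports "HOL-Probability.Probability"
begin

(* Continuous and discrete time at once: the statement assumes that T is one of these two
   domains, so an index range [0, t] reads {s \<in> T. s \<le> t}. *)
definition time_domain :: "real set \<Rightarrow> bool" where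
  "time_domain T \<longleftrightarrow> T = {0..} \<or> T = \<nat>"

(* S \<omega> \<tau> t is constrained only for \<tau> \<le> t in T. *)
definition random_service_process ::
    "'w measure \<Rightarrow> real set \<Rightarrow> ('w \<Rightarrow> real \<Rightarrow> real \<Rightarrow> real) \<Rightarrow> bool" where
  "random_service_process M T S \<longleftrightarrow>
     (\<forall>\<tau>\<in>T. \<forall>t\<in>T. \<tau> \<le> t \<longrightarrow>
        (\<lambda>\<omega>. S \<omega> \<tau> t) \<in> borel_measurable M \<and> (\<forall>\<omega>\<in>space M. 0 \<le> S \<omega> \<tau> t)) \<and>
     (\<forall>t\<in>T. \<forall>\<omega>\<in>space M. S \<omega> t t = 0)"

definition additive_service :: "real set \<Rightarrow> (real \<Rightarrow> real \<Rightarrow> real) \<Rightarrow> bool" where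
  "additive_service T s \<longleftrightarrow>
     (\<forall>r\<in>T. \<forall>t\<in>T. \<forall>u\<in>T. r \<le> t \<longrightarrow> t \<le> u \<longrightarrow> s r u = s r t + s t u)"

(* Extended real values, because the burst probe is an arrival function. *)
definition arrivals :: "real set \<Rightarrow> (real \<Rightarrow> ereal) \<Rightarrow> bool" where
  "arrivals T a \<longleftrightarrow> a 0 = 0 \<and> (\<forall>t\<in>T. 0 \<le> a t) \<and> mono_on T a"

(* Arrivals may depend on the sample path; deterministic arrivals are the case where
   A does not depend on \<omega>. *)
definition random_arrivals ::
    "'w measure \<Rightarrow> real set \<Rightarrow> ('w \<Rightarrow> real \<Rightarrow> ereal) \<Rightarrow> bool" where
  "random_arrivals M T A \<longleftrightarrow>
     (\<forall>\<omega>\<in>space M. arrivals T (A \<omega>)) \<and> (\<forall>t\<in>T. (\<lambda>\<omega>. A \<omega> t) \<in> borel_measurable M)"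

definition departures ::
    "real set \<Rightarrow> (real \<Rightarrow> real \<Rightarrow> real) \<Rightarrow> (real \<Rightarrow> ereal) \<Rightarrow> real \<Rightarrow> ereal" where
  "departures T s a t = (INF \<tau>\<in>{\<tau>\<in>T. \<tau> \<le> t}. a \<tau> + ereal (s \<tau> t))"

definition burst_probe :: "real \<Rightarrow> ereal" where
  "burst_probe t = (if t = 0 then 0 else \<infinity>)"

definition burst_response :: "real set \<Rightarrow> (real \<Rightarrow> real \<Rightarrow> real) \<Rightarrow> real \<Rightarrow> ereal" where
  "burst_response T s = departures T s burst_probe"

definition burst_service_curve ::
    "real set \<Rightarrow> ('w \<Rightarrow> real \<Rightarrow> real \<Rightarrow> real) \<Rightarrow> (real \<Rightarrow> 'w set) \<Rightarrow> real \<Rightarrow> real \<Rightarrow> ereal" where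
  "burst_service_curve T S \<Psi> \<tau> t =
     (INF \<psi>\<in>\<Psi> t. burst_response T (S \<psi>) t - burst_response T (S \<psi>) \<tau>)"

(* Measurability of the event is a premise in continuous time only; in discrete time it
   follows from the measurability of the random variables. *)
definition nonstationary_service_curve ::
    "'w measure \<Rightarrow> real set \<Rightarrow> ('w \<Rightarrow> real \<Rightarrow> real \<Rightarrow> real) \<Rightarrow> real \<Rightarrow> (real \<Rightarrow> real \<Rightarrow> ereal) \<Rightarrow> bool"
where
  "nonstationary_service_curve M T S \<epsilon> C \<longleftrightarrow>
     (\<forall>A. random_arrivals M T A \<longrightarrow>
       (\<forall>t\<in>T. 0 < t \<longrightarrow>
         (let E = {\<omega> \<in> space M.
                departures T (S \<omega>) (A \<omega>) t \<ge> (INF \<tau>\<in>{\<tau>\<in>T. \<tau> \<le> t}. A \<omega> \<tau> + C \<tau> t)}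
          in (T = {0..} \<longrightarrow> E \<in> sets M) \<longrightarrow> measure M E \<ge> 1 - \<epsilon>)))"

end

theory Submission
  imports Defs
begin

text \<open>
  For an additive service, D(t) - D(\<tau>) = S(\<tau>,t) on every sample path, so the infimum over
  \<open>\<Psi> t\<close> is at most S(\<tau>,t) on each path of \<open>\<Psi> t\<close>, for all \<open>\<tau>\<close> at once. Hence both events
  contain \<open>\<Psi> t\<close>, and no union bound over \<open>\<tau>\<close> is needed.
\<close>

lemma time_domain_zero: "time_domain T \<Longrightarrow> 0 \<in> T"
  by (auto simp: time_domain_def)

lemma time_domain_nonneg: "time_domain T \<Longrightarrow> t \<in> T \<Longrightarrow> 0 \<le> t"
  by (auto simp: time_domain_def Nats_def)

text \<open>The probe is infinite at every positive time, so only the term at time 0 is finite. That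
  term belongs to the infimum because \<open>0 \<in> T\<close> and times are non-negative.\<close>

lemma departures_burst_probe:
  assumes "time_domain T" and "t \<in> T"
  shows "departures T s burst_probe t = ereal (s 0 t)"
  unfolding departures_def
proof (rule antisym)
  have "0 \<in> {\<tau>\<in>T. \<tau> \<le> t}"
    using assms by (simp add: time_domain_zero time_domain_nonneg)
  then show "(INF \<tau>\<in>{\<tau>\<in>T. \<tau> \<le> t}. burst_probe \<tau> + ereal (s \<tau> t)) \<le> ereal (s 0 t)"
    by (rule INF_lower2) (simp add: burst_probe_def)
  show "ereal (s 0 t) \<le> (INF \<tau>\<in>{\<tau>\<in>T. \<tau> \<le> t}. burst_probe \<tau> + ereal (s \<tau> t))"
    by (rule INF_greatest) (simp add: burst_probe_def)
qed

text \<open>Both burst responses are finite, so the \<open>ereal\<close> difference is a difference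
  of reals; additivity at the times \<open>0 \<le> \<tau> \<le> t\<close> evaluates it.\<close>

lemma additive_burst_response_diff:
  assumes "time_domain T" and "additive_service T s"
    and "\<tau> \<in> T" and "t \<in> T" and "\<tau> \<le> t"
  shows "burst_response T s t - burst_response T s \<tau> = ereal (s \<tau> t)"
proof -
  have "s 0 t = s 0 \<tau> + s \<tau> t"
    using assms time_domain_zero[OF assms(1)] time_domain_nonneg[OF assms(1)]
    unfolding additive_service_def by blast
  then show ?thesis
    using assms by (simp add: burst_response_def departures_burst_probe)
qed

lemma burst_service_curve_le:
  assumes "time_domain T" and "additive_service T (S \<omega>)" and "\<omega> \<in> \<Psi> t"
    and "\<tau> \<in> T" and "t \<in> T" and "\<tau> \<le> t"
  shows "burst_service_curve T S \<Psi> \<tau> t \<le> ereal (S \<omega> \<tau> t)"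
  unfolding burst_service_curve_def
  using assms by (intro INF_lower2[where i = \<omega>]) (auto simp: additive_burst_response_diff)

text \<open>Supplies measurability in discrete time: the event is a countable intersection over
  \<open>\<tau>\<close>. The bound \<open>c\<close> does not depend on the sample path, so each
  single comparison is with a constant.\<close>

lemma sets_service_dominates:
  assumes "countable T" and "random_service_process M T S" and "t \<in> T"
  shows "{\<omega> \<in> space M. \<forall>\<tau>\<in>{\<tau>\<in>T. \<tau> \<le> t}. c \<tau> \<le> ereal (S \<omega> \<tau> t)} \<in> sets M"
proof (rule sets.sets_Collect_countable_All')
  show "countable {\<tau>\<in>T. \<tau> \<le> t}"
    using assms(1) by simp
  fix \<tau> assume "\<tau> \<in> {\<tau>\<in>T. \<tau> \<le> t}"
  then have [measurable]: "(\<lambda>\<omega>. S \<omega> \<tau> t) \<in> borel_measurable M"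
    using assms unfolding random_service_process_def by blast
  show "{\<omega> \<in> space M. c \<tau> \<le> ereal (S \<omega> \<tau> t)} \<in> sets M"
    by measurable
qed

text \<open>The discrete-time counterpart for departures: both sides of the comparison are infima of
  countably many measurable functions, with \<open>c\<close> again independent of the path.\<close>

lemma sets_departures_dominate:
  assumes "countable T" and "random_service_process M T S" and "random_arrivals M T A"
    and "t \<in> T"
  shows "{\<omega> \<in> space M. (INF \<tau>\<in>{\<tau>\<in>T. \<tau> \<le> t}. A \<omega> \<tau> + c \<tau>)
            \<le> departures T (S \<omega>) (A \<omega>) t} \<in> sets M"
proof -
  have count: "countable {\<tau>\<in>T. \<tau> \<le> t}"
    using assms(1) by simp
  have A: "(\<lambda>\<omega>. A \<omega> \<tau>) \<in> borel_measurable M" if "\<tau> \<in> T" for \<tau>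
    using assms(3) that unfolding random_arrivals_def by blast
  have S: "(\<lambda>\<omega>. S \<omega> \<tau> t) \<in> borel_measurable M" if "\<tau> \<in> T" "\<tau> \<le> t" for \<tau>
    using assms that unfolding random_service_process_def by blast
  have [measurable]: "(\<lambda>\<omega>. INF \<tau>\<in>{\<tau>\<in>T. \<tau> \<le> t}. A \<omega> \<tau> + c \<tau>) \<in> borel_measurable M"
    using count A by (intro borel_measurable_INF borel_measurable_ereal_add) auto
  have [measurable]: "(\<lambda>\<omega>. departures T (S \<omega>) (A \<omega>) t) \<in> borel_measurable M"
    unfolding departures_def
    using count A S
    by (intro borel_measurable_INF borel_measurable_ereal_add borel_measurable_ereal) auto
  show ?thesis
    by measurable
qed

text \<open>Carries a bound on the service over to the departures along one fixed path. Since the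
  bound holds at all \<open>\<tau>\<close> simultaneously, the infima compare term by term, even
  where \<open>a\<close> is infinite.\<close>

lemma departures_mono:
  assumes "\<And>\<tau>. \<tau> \<in> T \<Longrightarrow> \<tau> \<le> t \<Longrightarrow> c \<tau> \<le> ereal (s \<tau> t)"
  shows "(INF \<tau>\<in>{\<tau>\<in>T. \<tau> \<le> t}. a \<tau> + c \<tau>) \<le> departures T s a t"
  unfolding departures_def using assms by (intro INF_mono) (auto intro: add_left_mono)

theorem mainTheorem9:
  fixes M :: "'w measure"
    and T :: "real set"
    and S :: "'w \<Rightarrow> real \<Rightarrow> real \<Rightarrow> real"
    and \<Psi> :: "real \<Rightarrow> 'w set"
    and \<epsilon> :: real
  assumes "prob_space M"
    and "time_domain T"
    and "random_service_process M T S"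
    and "\<And>\<omega>. \<omega> \<in> space M \<Longrightarrow> additive_service T (S \<omega>)"
    and "0 < \<epsilon>" and "\<epsilon> \<le> 1"
    and "\<And>t. t \<in> T \<Longrightarrow> 0 < t \<Longrightarrow> \<Psi> t \<in> sets M \<and> \<Psi> t \<noteq> {} \<and> measure M (\<Psi> t) \<ge> 1 - \<epsilon>"
  shows "(\<forall>\<omega>\<in>space M. \<forall>t\<in>T. burst_response T (S \<omega>) t = ereal (S \<omega> 0 t)) \<and>
     (\<forall>t\<in>T. 0 < t \<longrightarrow>
        (let E = {\<omega> \<in> space M. \<forall>\<tau>\<in>{\<tau>\<in>T. \<tau> \<le> t}.
               ereal (S \<omega> \<tau> t) \<ge> burst_service_curve T S \<Psi> \<tau> t}
         in (T = {0..} \<longrightarrow> E \<in> sets M) \<longrightarrow> measure M E \<ge> 1 - \<epsilon>)) \<and>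
     nonstationary_service_curve M T S \<epsilon> (burst_service_curve T S \<Psi>)"
proof -
  interpret prob_space M by fact
  note T = \<open>time_domain T\<close> and S = \<open>random_service_process M T S\<close>
  have countable: "countable T" if "T \<noteq> {0..}"
    using T that by (auto simp: time_domain_def Nats_def)
  \<comment> \<open>Both probability bounds reduce to this monotonicity. Measurability of
    \<open>E\<close> matters: \<open>measure\<close> takes the value 0 on sets outside
    \<open>sets M\<close>.\<close>
  have prob_ge: "1 - \<epsilon> \<le> measure M E" if "t \<in> T" "0 < t" "E \<in> sets M" "\<Psi> t \<subseteq> E" for t E
    using assms(7)[OF that(1,2)] finite_measure_mono[OF that(4,3)] by linarith
  have space: "\<Psi> t \<subseteq> space M" if "t \<in> T" "0 < t" for t
    using assms(7)[OF that] sets.sets_into_space by blast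
  have curve_le: "burst_service_curve T S \<Psi> \<tau> t \<le> ereal (S \<omega> \<tau> t)"
    if "t \<in> T" "0 < t" "\<omega> \<in> \<Psi> t" "\<tau> \<in> T" "\<tau> \<le> t" for t \<tau> \<omega>
    \<comment> \<open>Additivity is assumed on \<open>space M\<close> only, so
      \<open>\<omega>\<close> must first be placed there.\<close>
    using space[OF that(1,2)] that T assms(4) by (intro burst_service_curve_le) auto
  have "burst_response T (S \<omega>) t = ereal (S \<omega> 0 t)" if "t \<in> T" for \<omega> t
    using T that by (simp add: burst_response_def departures_burst_probe)
  moreover have "\<forall>t\<in>T. 0 < t \<longrightarrow>
      (let E = {\<omega> \<in> space M. \<forall>\<tau>\<in>{\<tau>\<in>T. \<tau> \<le> t}.
           burst_service_curve T S \<Psi> \<tau> t \<le> ereal (S \<omega> \<tau> t)}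
       in (T = {0..} \<longrightarrow> E \<in> sets M) \<longrightarrow> 1 - \<epsilon> \<le> measure M E)"
    unfolding Let_def
  proof (intro ballI impI)
    fix t
    let ?E = "{\<omega> \<in> space M. \<forall>\<tau>\<in>{\<tau>\<in>T. \<tau> \<le> t}.
      burst_service_curve T S \<Psi> \<tau> t \<le> ereal (S \<omega> \<tau> t)}"
    assume t: "t \<in> T" "0 < t" and meas: "T = {0..} \<longrightarrow> ?E \<in> sets M"
    show "1 - \<epsilon> \<le> measure M ?E"
    proof (rule prob_ge[OF t])
      \<comment> \<open>In continuous time this is the premise \<open>meas\<close>; otherwise
        \<open>T\<close> is countable and the measurability lemma applies.\<close>
      show "?E \<in> sets M"
        using meas countable
          sets_service_dominates[OF _ S t(1), of "\<lambda>\<tau>. burst_service_curve T S \<Psi> \<tau> t"]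
        by blast
      show "\<Psi> t \<subseteq> ?E"
        using t space curve_le by blast
    qed
  qed
  moreover have "nonstationary_service_curve M T S \<epsilon> (burst_service_curve T S \<Psi>)"
    unfolding nonstationary_service_curve_def Let_def
  proof (intro allI ballI impI)
    fix A t
    let ?E = "{\<omega> \<in> space M. (INF \<tau>\<in>{\<tau>\<in>T. \<tau> \<le> t}. A \<omega> \<tau> + burst_service_curve T S \<Psi> \<tau> t)
      \<le> departures T (S \<omega>) (A \<omega>) t}"
    assume A: "random_arrivals M T A" and t: "t \<in> T" "0 < t"
      and meas: "T = {0..} \<longrightarrow> ?E \<in> sets M"
    show "1 - \<epsilon> \<le> measure M ?E"
    proof (rule prob_ge[OF t])
      show "?E \<in> sets M"
        using meas countable
          sets_departures_dominate[OF _ S A t(1), of "\<lambda>\<tau>. burst_service_curve T S \<Psi> \<tau> t"]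
        by blast
      \<comment> \<open>The arrivals may vary with the path, but the comparison is made path by
        path, so \<open>A \<omega>\<close> enters as a fixed function.\<close>
      show "\<Psi> t \<subseteq> ?E"
        using t space curve_le by (auto intro!: departures_mono)
    qed
  qed
  ultimately show ?thesis
    by blast
qed

end
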